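(* The assignments $L$ (sending a group $B$ of nilpotency class 2 with 2-divisible center to the Lie ring $L(B)$, and a group homomorphism $f$ to $L(f)=f$) and $E$ (sending a Lie ring $\mathfrak b$ of nilpotency class 2 with 2-divisible center to the group $E(\mathfrak b)$, and a Lie ring homomorphism $f$ to $E(f)=f$) are mutually inverse functors, defining an isomorphism between the category of groups of nilpotency class 2 with 2-divisible center (with group homomorphisms) and the category of Lie rings of nilpotency class 2 with 2-divisible center (with Lie ring homomorphisms).
   Context: A Lie ring is an abelian group with a biadditive bracket $[\cdot,\cdot]$ satisfying $[a,a]=0$ for all $a$ and the Jacobi identity; it is commutative if the bracket is zero. A group $B$ is said to be of nilpotency class 2 if $B/A$ is abelian, where $A$ is the center of $B$ (so abelian groups are included). Likewise a Lie ring $\mathfrak b$ is of nilpotency class 2 if $\mathfrak b/\mathfrak a$ is commutative, where $\mathfrak a$ is the center of $\mathfrak b$. An abelian group $A$ (written additively) is 2-divisible if $a\mapsto a+a$ is an automorphism of $A$; then $a/2$ denotes the image of $a$ under the inverse automorphism. Definition of $L$. Let $B$ be a group of nilpotency class 2 with 2-divisible center $A$, and $C=B/A$ (both $A$, $C$ written additively). Choose a set-theoretic section $s:C\to B$ of $B\to C$; every $b\in B$ is uniquely $b=a\cdot s(c)$ with $a\in A$, $c\in C$, and is written $b=(a,c)$. Then $(a_1,c_1)\cdot(a_2,c_2)=(a_1+a_2+\psi(c_1,c_2),\,c_1+c_2)$, where $\psi(c_1,c_2)=s(c_1)s(c_2)s(c_1+c_2)^{-1}\in A$. Put $\phi(c_1,c_2)=\frac{\psi(c_1,c_2)+\psi(c_2,c_1)}{2}$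 and $\eta(c_1,c_2)=\psi(c_1,c_2)-\psi(c_2,c_1)$. $L(B)$ is the Lie ring with the same underlying set as $B$, with addition $(a_1,c_1)+(a_2,c_2)=(a_1+a_2+\phi(c_1,c_2),\,c_1+c_2)$ and bracket $[(a_1,c_1),(a_2,c_2)]=\eta(c_1,c_2)$, regarded as an element of $A\subset B$ (that is, the pair $(\eta(c_1,c_2)-\phi(0,0),0)$). This structure does not depend on the choice of $s$. Definition of $E$. Let $\mathfrak b$ be a Lie ring of nilpotency class 2 with 2-divisible center $\mathfrak a$, and $\mathfrak c=\mathfrak b/\mathfrak a$. Choose a set-theoretic section $s:\mathfrak c\to\mathfrak b$, write each $b\in\mathfrak b$ uniquely as $b=a+s(c)$, denoted $(a,c)$, and put $\phi(c_1,c_2)=s(c_1)+s(c_2)-s(c_1+c_2)\in\mathfrak a$, $\eta(c_1,c_2)=[s(c_1),s(c_2)]\in\mathfrak a$, $\psi(c_1,c_2)=\phi(c_1,c_2)+\frac{\eta(c_1,c_2)}{2}$. $E(\mathfrak b)$ is the group with the same underlying set as $\mathfrak b$ and with multiplication $(a_1,c_1)\cdot(a_2,c_2)=(a_1+a_2+\psi(c_1,c_2),\,c_1+c_2)$. This structure does not depend on the choice of $s$. On morphisms: for a group homomorphism $f:B_1\to B_2$, $L(f)$ is the same map $f$ regarded as a map $L(B_1)\to L(B_2)$; for a Lie ring homomorphism $f:\mathfrak b_1\to\mathfrak b_2$, $E(f)$ is the same map $f$ regarded as a map $E(\mathfrak b_1)\to E(\mathfrak b_2)$. *)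

theory Defs
  imports "HOL-Algebra.QuotRing"
begin

section \<open>Categories, functors, isomorphisms of categories\<close>

text \<open>Morphisms are typed by their domain and codomain, so hom-sets need not be disjoint.
  \<^term>\<open>Comp C X Y Z g f\<close> is the composite \<open>g \<circ> f\<close> of \<open>f : X \<rightarrow> Y\<close> and \<open>g : Y \<rightarrow> Z\<close>.\<close>

record ('o, 'm) cat =
  Obj :: "'o set"
  Hom :: "'o \<Rightarrow> 'o \<Rightarrow> 'm set"
  Ident :: "'o \<Rightarrow> 'm"
  Comp :: "'o \<Rightarrow> 'o \<Rightarrow> 'o \<Rightarrow> 'm \<Rightarrow> 'm \<Rightarrow> 'm"

definition category :: "('o, 'm) cat \<Rightarrow> bool" where
  "category C \<longleftrightarrow>
     (\<forall>X\<in>Obj C. Ident C X \<in> Hom C X X) \<and>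
     (\<forall>X\<in>Obj C. \<forall>Y\<in>Obj C. \<forall>Z\<in>Obj C. \<forall>f\<in>Hom C X Y. \<forall>g\<in>Hom C Y Z.
        Comp C X Y Z g f \<in> Hom C X Z) \<and>
     (\<forall>X\<in>Obj C. \<forall>Y\<in>Obj C. \<forall>f\<in>Hom C X Y.
        Comp C X X Y f (Ident C X) = f \<and> Comp C X Y Y (Ident C Y) f = f) \<and>
     (\<forall>W\<in>Obj C. \<forall>X\<in>Obj C. \<forall>Y\<in>Obj C. \<forall>Z\<in>Obj C.
        \<forall>f\<in>Hom C W X. \<forall>g\<in>Hom C X Y. \<forall>h\<in>Hom C Y Z.
        Comp C W Y Z h (Comp C W X Y g f) = Comp C W X Z (Comp C X Y Z h g) f)"

definition is_functor ::
    "('o, 'm) cat \<Rightarrow> ('p, 'n) cat \<Rightarrow> ('o \<Rightarrow> 'p) \<Rightarrow> ('o \<Rightarrow> 'o \<Rightarrow> 'm \<Rightarrow> 'n) \<Rightarrow> bool" where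
  "is_functor C D Fo Fm \<longleftrightarrow>
     category C \<and> category D \<and>
     (\<forall>X\<in>Obj C. Fo X \<in> Obj D) \<and>
     (\<forall>X\<in>Obj C. \<forall>Y\<in>Obj C. \<forall>f\<in>Hom C X Y. Fm X Y f \<in> Hom D (Fo X) (Fo Y)) \<and>
     (\<forall>X\<in>Obj C. Fm X X (Ident C X) = Ident D (Fo X)) \<and>
     (\<forall>X\<in>Obj C. \<forall>Y\<in>Obj C. \<forall>Z\<in>Obj C. \<forall>f\<in>Hom C X Y. \<forall>g\<in>Hom C Y Z.
        Fm X Z (Comp C X Y Z g f) = Comp D (Fo X) (Fo Y) (Fo Z) (Fm Y Z g) (Fm X Y f))"

text \<open>The composite of \<open>F : C \<rightarrow> D\<close> followed by \<open>G : D \<rightarrow> C\<close> is the identity functor of \<open>C\<close>.\<close>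

definition left_inverse_functor ::
    "('o, 'm) cat \<Rightarrow> ('o \<Rightarrow> 'p) \<Rightarrow> ('o \<Rightarrow> 'o \<Rightarrow> 'm \<Rightarrow> 'n) \<Rightarrow>
     ('p \<Rightarrow> 'o) \<Rightarrow> ('p \<Rightarrow> 'p \<Rightarrow> 'n \<Rightarrow> 'm) \<Rightarrow> bool" where
  "left_inverse_functor C Fo Fm Go Gm \<longleftrightarrow>
     (\<forall>X\<in>Obj C. Go (Fo X) = X) \<and>
     (\<forall>X\<in>Obj C. \<forall>Y\<in>Obj C. \<forall>f\<in>Hom C X Y. Gm (Fo X) (Fo Y) (Fm X Y f) = f)"

definition category_isomorphism ::
    "('o, 'm) cat \<Rightarrow> ('p, 'n) cat \<Rightarrow> ('o \<Rightarrow> 'p) \<Rightarrow> ('o \<Rightarrow> 'o \<Rightarrow> 'm \<Rightarrow> 'n) \<Rightarrow>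
     ('p \<Rightarrow> 'o) \<Rightarrow> ('p \<Rightarrow> 'p \<Rightarrow> 'n \<Rightarrow> 'm) \<Rightarrow> bool" where
  "category_isomorphism C D Fo Fm Go Gm \<longleftrightarrow>
     is_functor C D Fo Fm \<and> is_functor D C Go Gm \<and>
     left_inverse_functor C Fo Fm Go Gm \<and> left_inverse_functor D Go Gm Fo Fm"


section \<open>Division by 2 and sections of quotient maps\<close>

text \<open>Abelian groups are HOL-Algebra groups, hence in multiplicative notation:
  \<open>a \<otimes> a\<close> plays the role of \<open>a + a\<close>.\<close>

definition two_divisible :: "('a, 'b) monoid_scheme \<Rightarrow> bool" where
  "two_divisible A \<longleftrightarrow> (\<lambda>a. a \<otimes>\<^bsub>A\<^esub> a) \<in> iso A A"

definition halve :: "('a, 'b) monoid_scheme \<Rightarrow> 'a \<Rightarrow> 'a" where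
  "halve A = inv_into (carrier A) (\<lambda>a. a \<otimes>\<^bsub>A\<^esub> a)"

definition is_section :: "('a, 'b) monoid_scheme \<Rightarrow> 'a set \<Rightarrow> ('a set \<Rightarrow> 'a) \<Rightarrow> bool" where
  "is_section G A s \<longleftrightarrow>
     (\<forall>c\<in>carrier (G Mod A). s c \<in> carrier G \<and> A #>\<^bsub>G\<^esub> s c = c)"

text \<open>The coordinates \<open>(a, c)\<close> of \<open>b = a s(c)\<close> with respect to a section \<open>s\<close>, and the element
  with given coordinates.\<close>

definition quot_coord :: "('a, 'b) monoid_scheme \<Rightarrow> 'a set \<Rightarrow> 'a \<Rightarrow> 'a set" where
  "quot_coord G A b = A #>\<^bsub>G\<^esub> b"

definition sub_coord ::
    "('a, 'b) monoid_scheme \<Rightarrow> 'a set \<Rightarrow> ('a set \<Rightarrow> 'a) \<Rightarrow> 'a \<Rightarrow> 'a" where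
  "sub_coord G A s b = b \<otimes>\<^bsub>G\<^esub> inv\<^bsub>G\<^esub> s (quot_coord G A b)"

definition from_coords ::
    "('a, 'b) monoid_scheme \<Rightarrow> ('a set \<Rightarrow> 'a) \<Rightarrow> 'a \<Rightarrow> 'a set \<Rightarrow> 'a" where
  "from_coords G s a c = a \<otimes>\<^bsub>G\<^esub> s c"

definition section_cocycle ::
    "('a, 'b) monoid_scheme \<Rightarrow> 'a set \<Rightarrow> ('a set \<Rightarrow> 'a) \<Rightarrow> 'a set \<Rightarrow> 'a set \<Rightarrow> 'a" where
  "section_cocycle G A s c1 c2 =
     s c1 \<otimes>\<^bsub>G\<^esub> s c2 \<otimes>\<^bsub>G\<^esub> inv\<^bsub>G\<^esub> s (c1 \<otimes>\<^bsub>G Mod A\<^esub> c2)"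


section \<open>Groups of nilpotency class 2\<close>

definition center :: "('a, 'b) monoid_scheme \<Rightarrow> 'a set" where
  "center B = {z \<in> carrier B. \<forall>x\<in>carrier B. z \<otimes>\<^bsub>B\<^esub> x = x \<otimes>\<^bsub>B\<^esub> z}"

definition center_group :: "'a monoid \<Rightarrow> 'a monoid" where
  "center_group B = B\<lparr>carrier := center B\<rparr>"

definition group_class2 :: "'a monoid \<Rightarrow> bool" where
  "group_class2 B \<longleftrightarrow> group B \<and> comm_group (B Mod center B)"

text \<open>HOL functions are total, so a group operation is pinned down as a function
  \<open>carrier B \<times> carrier B \<rightarrow> carrier B\<close> only by extensionality outside the carrier. Requiring this
  of objects and morphisms makes record equality and function equality the set-theoretic
  ones.\<close>

definition groups_class2 :: "('a monoid, 'a \<Rightarrow> 'a) cat" where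
  "groups_class2 =
    \<lparr>Obj = {B. group_class2 B \<and> two_divisible (center_group B) \<and>
              mult B \<in> carrier B \<rightarrow>\<^sub>E carrier B \<rightarrow>\<^sub>E carrier B},
     Hom = (\<lambda>B1 B2. hom B1 B2 \<inter> extensional (carrier B1)),
     Ident = (\<lambda>B. \<lambda>x\<in>carrier B. x),
     Comp = (\<lambda>B1 B2 B3 g f. compose (carrier B1) g f)\<rparr>"


section \<open>Lie rings of nilpotency class 2\<close>

record 'a lie =
  lcarrier :: "'a set"
  ladd :: "'a \<Rightarrow> 'a \<Rightarrow> 'a"
  lzero :: "'a"
  lbracket :: "'a \<Rightarrow> 'a \<Rightarrow> 'a"

definition add_group :: "'a lie \<Rightarrow> 'a monoid" where
  "add_group R = \<lparr>carrier = lcarrier R, mult = ladd R, one = lzero R\<rparr>"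

definition lie_ring :: "'a lie \<Rightarrow> bool" where
  "lie_ring R \<longleftrightarrow>
     comm_group (add_group R) \<and>
     (\<forall>x\<in>lcarrier R. \<forall>y\<in>lcarrier R. lbracket R x y \<in> lcarrier R) \<and>
     (\<forall>x\<in>lcarrier R. \<forall>y\<in>lcarrier R. \<forall>z\<in>lcarrier R.
        lbracket R (ladd R x y) z = ladd R (lbracket R x z) (lbracket R y z) \<and>
        lbracket R x (ladd R y z) = ladd R (lbracket R x y) (lbracket R x z)) \<and>
     (\<forall>x\<in>lcarrier R. lbracket R x x = lzero R) \<and>
     (\<forall>x\<in>lcarrier R. \<forall>y\<in>lcarrier R. \<forall>z\<in>lcarrier R.
        ladd R (ladd R (lbracket R x (lbracket R y z)) (lbracket R y (lbracket R z x)))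
               (lbracket R z (lbracket R x y)) = lzero R)"

definition lie_commutative :: "'a lie \<Rightarrow> bool" where
  "lie_commutative R \<longleftrightarrow> (\<forall>x\<in>lcarrier R. \<forall>y\<in>lcarrier R. lbracket R x y = lzero R)"

definition lie_center :: "'a lie \<Rightarrow> 'a set" where
  "lie_center R = {z \<in> lcarrier R. \<forall>x\<in>lcarrier R. lbracket R z x = lzero R}"

definition lie_center_group :: "'a lie \<Rightarrow> 'a monoid" where
  "lie_center_group R = (add_group R)\<lparr>carrier := lie_center R\<rparr>"

text \<open>The quotient by an ideal \<open>I\<close>; the union defining the bracket of two cosets is the coset
  of the bracket of any two representatives, as in \<^const>\<open>rcoset_mult\<close>.\<close>

definition lie_quotient :: "'a lie \<Rightarrow> 'a set \<Rightarrow> 'a set lie" where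
  "lie_quotient R I =
    \<lparr>lcarrier = carrier (add_group R Mod I),
     ladd = mult (add_group R Mod I),
     lzero = one (add_group R Mod I),
     lbracket = (\<lambda>X Y. \<Union>x\<in>X. \<Union>y\<in>Y. I #>\<^bsub>add_group R\<^esub> lbracket R x y)\<rparr>"

definition lie_class2 :: "'a lie \<Rightarrow> bool" where
  "lie_class2 R \<longleftrightarrow> lie_ring R \<and> lie_commutative (lie_quotient R (lie_center R))"

definition lie_hom :: "'a lie \<Rightarrow> 'b lie \<Rightarrow> ('a \<Rightarrow> 'b) set" where
  "lie_hom R S =
     {f \<in> hom (add_group R) (add_group S).
        \<forall>x\<in>lcarrier R. \<forall>y\<in>lcarrier R. f (lbracket R x y) = lbracket S (f x) (f y)}"

definition lie_rings_class2 :: "('a lie, 'a \<Rightarrow> 'a) cat" where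
  "lie_rings_class2 =
    \<lparr>Obj = {R. lie_class2 R \<and> two_divisible (lie_center_group R) \<and>
              ladd R \<in> lcarrier R \<rightarrow>\<^sub>E lcarrier R \<rightarrow>\<^sub>E lcarrier R \<and>
              lbracket R \<in> lcarrier R \<rightarrow>\<^sub>E lcarrier R \<rightarrow>\<^sub>E lcarrier R},
     Hom = (\<lambda>R S. lie_hom R S \<inter> extensional (lcarrier R)),
     Ident = (\<lambda>R. \<lambda>x\<in>lcarrier R. x),
     Comp = (\<lambda>R S T g f. compose (lcarrier R) g f)\<rparr>"


section \<open>The functor L\<close>

definition L_phi :: "'a monoid \<Rightarrow> ('a set \<Rightarrow> 'a) \<Rightarrow> 'a set \<Rightarrow> 'a set \<Rightarrow> 'a" where
  "L_phi B s c1 c2 =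
     (let \<psi> = section_cocycle B (center B) s
      in halve (center_group B) (\<psi> c1 c2 \<otimes>\<^bsub>B\<^esub> \<psi> c2 c1))"

definition L_eta :: "'a monoid \<Rightarrow> ('a set \<Rightarrow> 'a) \<Rightarrow> 'a set \<Rightarrow> 'a set \<Rightarrow> 'a" where
  "L_eta B s c1 c2 =
     (let \<psi> = section_cocycle B (center B) s in \<psi> c1 c2 \<otimes>\<^bsub>B\<^esub> inv\<^bsub>B\<^esub> \<psi> c2 c1)"

text \<open>The zero of \<open>L(B)\<close> is determined by its addition: it is the pair
  \<open>(- \<phi>(0,0), 0)\<close>, and since \<open>\<phi>(0,0) = \<psi>(0,0) = s(0)\<close> this is the identity of \<open>B\<close>.\<close>

definition L_wrt :: "'a monoid \<Rightarrow> ('a set \<Rightarrow> 'a) \<Rightarrow> 'a lie" where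
  "L_wrt B s =
     (let a = sub_coord B (center B) s; c = quot_coord B (center B) in
      \<lparr>lcarrier = carrier B,
       ladd = (\<lambda>x\<in>carrier B. \<lambda>y\<in>carrier B.
                 from_coords B s (a x \<otimes>\<^bsub>B\<^esub> a y \<otimes>\<^bsub>B\<^esub> L_phi B s (c x) (c y))
                                 (c x \<otimes>\<^bsub>B Mod center B\<^esub> c y)),
       lzero = \<one>\<^bsub>B\<^esub>,
       lbracket = (\<lambda>x\<in>carrier B. \<lambda>y\<in>carrier B. L_eta B s (c x) (c y))\<rparr>)"

definition L_obj :: "'a monoid \<Rightarrow> 'a lie" where
  "L_obj B = L_wrt B (SOME s. is_section B (center B) s)"

definition L_mor :: "'a monoid \<Rightarrow> 'a monoid \<Rightarrow> ('a \<Rightarrow> 'a) \<Rightarrow> ('a \<Rightarrow> 'a)" where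
  "L_mor B1 B2 f = f"


section \<open>The functor E\<close>

definition E_phi :: "'a lie \<Rightarrow> ('a set \<Rightarrow> 'a) \<Rightarrow> 'a set \<Rightarrow> 'a set \<Rightarrow> 'a" where
  "E_phi R s = section_cocycle (add_group R) (lie_center R) s"

definition E_eta :: "'a lie \<Rightarrow> ('a set \<Rightarrow> 'a) \<Rightarrow> 'a set \<Rightarrow> 'a set \<Rightarrow> 'a" where
  "E_eta R s c1 c2 = lbracket R (s c1) (s c2)"

definition E_psi :: "'a lie \<Rightarrow> ('a set \<Rightarrow> 'a) \<Rightarrow> 'a set \<Rightarrow> 'a set \<Rightarrow> 'a" where
  "E_psi R s c1 c2 =
     ladd R (E_phi R s c1 c2) (halve (lie_center_group R) (E_eta R s c1 c2))"

text \<open>The identity of \<open>E(R)\<close> is determined by its multiplication: it is the pair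
  \<open>(- \<psi>(0,0), 0)\<close>, and since \<open>\<psi>(0,0) = \<phi>(0,0) = s(0)\<close> this is the zero of \<open>R\<close>.\<close>

definition E_wrt :: "'a lie \<Rightarrow> ('a set \<Rightarrow> 'a) \<Rightarrow> 'a monoid" where
  "E_wrt R s =
     (let a = sub_coord (add_group R) (lie_center R) s;
          c = quot_coord (add_group R) (lie_center R) in
      \<lparr>carrier = lcarrier R,
       mult = (\<lambda>x\<in>lcarrier R. \<lambda>y\<in>lcarrier R.
                 from_coords (add_group R) s
                   (ladd R (ladd R (a x) (a y)) (E_psi R s (c x) (c y)))
                   (ladd (lie_quotient R (lie_center R)) (c x) (c y))),
       one = lzero R\<rparr>)"

definition E_obj :: "'a lie \<Rightarrow> 'a monoid" where
  "E_obj R = E_wrt R (SOME s. is_section (add_group R) (lie_center R) s)"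

definition E_mor :: "'a lie \<Rightarrow> 'a lie \<Rightarrow> ('a \<Rightarrow> 'a) \<Rightarrow> ('a \<Rightarrow> 'a)" where
  "E_mor R S f = f"

end

theory Submission
  imports Defs
begin

text \<open>In coordinate-free form, with \<open>h\<close> halving in the center, \<open>L\<close> replaces the product by
  \<open>x + y = x y h([x, y])\<^sup>-\<^sup>1\<close> and takes the group commutator as bracket, while \<open>E\<close> replaces the
  sum by \<open>x y = x + y + h([x, y])\<close>. In particular neither depends on the section, and since
  \<open>[x, y]\<close> and the center are the same for both structures, the two formulas invert each other.
  Functoriality is not immediate because homomorphisms need not preserve centers; it holds
  because neither structure has nontrivial elements of order 2: if \<open>w\<close> is one, then \<open>[w, y]\<close> has
  trivial square and is central, so \<open>[w, y]\<close> vanishes for all \<open>y\<close>, hence \<open>w\<close> itself is central.\<close>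

section \<open>Halving in a 2-divisible group\<close>

lemma halve_closed:
  assumes "two_divisible A" "a \<in> carrier A"
  shows "halve A a \<in> carrier A"
    and "halve A a \<otimes>\<^bsub>A\<^esub> halve A a = a"
proof -
  have "a \<in> (\<lambda>a. a \<otimes>\<^bsub>A\<^esub> a) ` carrier A"
    using assms by (simp add: two_divisible_def iso_def bij_betw_def)
  then show "halve A a \<in> carrier A" "halve A a \<otimes>\<^bsub>A\<^esub> halve A a = a"
    unfolding halve_def by (rule inv_into_into, rule f_inv_into_f)
qed

text \<open>Doubling is injective on \<open>A\<close>, so a half is recognised by its double.
  Additivity of \<open>halve\<close> and its agreement across the two structures are proved this
  way.\<close>

lemma halve_unique:
  assumes "two_divisible A" "b \<in> carrier A" "b \<otimes>\<^bsub>A\<^esub> b = a"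
  shows "halve A a = b"
  using assms unfolding halve_def two_divisible_def iso_def bij_betw_def
  by (auto intro: inv_into_f_f)

text \<open>Serves to move 2-divisibility between the center of a group and that of its Lie ring:
  the two operations are different functions but agree on central elements.\<close>

lemma two_divisible_cong:
  assumes "two_divisible A" "carrier A' = carrier A"
    and "\<And>a b. a \<in> carrier A \<Longrightarrow> b \<in> carrier A \<Longrightarrow> a \<otimes>\<^bsub>A'\<^esub> b = a \<otimes>\<^bsub>A\<^esub> b"
    and "\<And>a b. a \<in> carrier A \<Longrightarrow> b \<in> carrier A \<Longrightarrow> a \<otimes>\<^bsub>A\<^esub> b \<in> carrier A"
  shows "two_divisible A'"
proof -
  have "bij_betw (\<lambda>a. a \<otimes>\<^bsub>A'\<^esub> a) (carrier A) (carrier A) = bij_betw (\<lambda>a. a \<otimes>\<^bsub>A\<^esub> a) (carrier A) (carrier A)"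
    by (rule bij_betw_cong) (simp add: assms(3))
  with assms show ?thesis
    by (auto simp: two_divisible_def iso_def hom_def)
qed

section \<open>Cosets, sections and cocycles of a normal subgroup\<close>

lemma (in normal) is_section_some:
  "is_section G H (SOME s. is_section G H s)"
proof -
  have "\<exists>x. x \<in> carrier G \<and> H #> x = c" if "c \<in> carrier (G Mod H)" for c
    using that by (auto simp: FactGroup_def RCOSETS_def)
  then have "is_section G H (\<lambda>c. SOME x. x \<in> carrier G \<and> H #> x = c)"
    unfolding is_section_def by (metis (mono_tags, lifting) someI_ex)
  \<comment> \<open>Sections exist, so the \<open>SOME\<close> in \<open>L_obj\<close> and
    \<open>E_obj\<close> picks an actual section.\<close>
  then show ?thesis by (rule someI[of "is_section G H"])
qed

lemma (in normal) rcos_eq_iff: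
  assumes "x \<in> carrier G" "y \<in> carrier G"
  shows "H #> x = H #> y \<longleftrightarrow> x \<otimes> inv y \<in> H"
  using assms rcos_module[OF is_group, of y x] rcos_self[OF assms(1)] repr_independence[of x H y]
  by (metis is_group is_subgroup rcos_module_imp subgroup_axioms)

context normal
begin

context
  fixes s assumes s: "is_section G H s"
begin

lemma section_coset:
  assumes "x \<in> carrier G"
  shows "s (H #> x) \<in> carrier G" and "H #> s (H #> x) = H #> x"
proof -
  have "H #> x \<in> carrier (G Mod H)"
    using assms by (auto simp: FactGroup_def RCOSETS_def)
  then show "s (H #> x) \<in> carrier G" "H #> s (H #> x) = H #> x"
    using s by (auto simp: is_section_def)
qed

lemma sub_coord_mem:
  assumes "x \<in> carrier G"
  shows "sub_coord G H s x \<in> H" "x = sub_coord G H s x \<otimes> s (H #> x)"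
proof -
  show "sub_coord G H s x \<in> H"
    using section_coset[OF assms] assms rcos_eq_iff[of x "s (H #> x)"]
    by (simp add: sub_coord_def quot_coord_def)
  show "x = sub_coord G H s x \<otimes> s (H #> x)"
    using section_coset[OF assms] assms
    by (simp add: sub_coord_def quot_coord_def m_assoc)
qed

text \<open>The quotient map is multiplicative, so the product of the two representatives and the
  representative of the product coset lie in the same coset of \<open>H\<close>; the cocycle is the
  element of \<open>H\<close> by which they differ.\<close>

lemma section_cocycle_mem:
  assumes "x \<in> carrier G" "y \<in> carrier G"
  shows "section_cocycle G H s (H #> x) (H #> y) \<in> H"
    "s (H #> x) \<otimes> s (H #> y) = section_cocycle G H s (H #> x) (H #> y) \<otimes> s (H #> (x \<otimes> y))"
proof -
  note c = section_coset[OF assms(1)] section_coset[OF assms(2)]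
  have m: "(H #> x) <#> (H #> y) = H #> (x \<otimes> y)"
    using assms by (rule rcos_sum)
  have "H #> (s (H #> x) \<otimes> s (H #> y)) = (H #> s (H #> x)) <#> (H #> s (H #> y))"
    by (rule rcos_sum[symmetric]) (fact c)+
  also have "\<dots> = H #> s (H #> (x \<otimes> y))"
    using c m section_coset[of "x \<otimes> y"] assms by simp
  finally show "section_cocycle G H s (H #> x) (H #> y) \<in> H"
    using c m section_coset[of "x \<otimes> y"] assms rcos_eq_iff[of "s (H #> x) \<otimes> s (H #> y)" "s (H #> (x \<otimes> y))"]
    by (simp add: section_cocycle_def FactGroup_def)
  show "s (H #> x) \<otimes> s (H #> y) = section_cocycle G H s (H #> x) (H #> y) \<otimes> s (H #> (x \<otimes> y))"
    using c m section_coset[of "x \<otimes> y"] assms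
    by (simp add: section_cocycle_def FactGroup_def m_assoc)
qed

end

end

section \<open>Commutators and the center of a group\<close>

definition commutator :: "('a, 'b) monoid_scheme \<Rightarrow> 'a \<Rightarrow> 'a \<Rightarrow> 'a" where
  "commutator G x y = x \<otimes>\<^bsub>G\<^esub> y \<otimes>\<^bsub>G\<^esub> inv\<^bsub>G\<^esub> (y \<otimes>\<^bsub>G\<^esub> x)"

context group
begin

lemma center_closed: "z \<in> center G \<Longrightarrow> z \<in> carrier G"
  by (simp add: center_def)

lemma center_comm: "z \<in> center G \<Longrightarrow> x \<in> carrier G \<Longrightarrow> x \<otimes> z = z \<otimes> x"
  by (simp add: center_def)

lemma center_left_comm:
  "z \<in> center G \<Longrightarrow> x \<in> carrier G \<Longrightarrow> y \<in> carrier G \<Longrightarrow> x \<otimes> (z \<otimes> y) = z \<otimes> (x \<otimes> y)"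
  by (simp add: center_closed center_comm[of z x] flip: m_assoc)

lemma inv_comm:
  assumes "z \<in> carrier G" "x \<in> carrier G" "z \<otimes> x = x \<otimes> z"
  shows "inv z \<otimes> x = x \<otimes> inv z"
proof -
  have "inv z \<otimes> x = inv z \<otimes> (x \<otimes> z) \<otimes> inv z"
    using assms(1,2) by (simp add: m_assoc)
  also have "\<dots> = inv z \<otimes> (z \<otimes> x) \<otimes> inv z"
    by (simp only: assms(3))
  also have "inv z \<otimes> (z \<otimes> x) = x"
    using assms(1,2) by (simp flip: m_assoc)
  finally show ?thesis .
qed

lemma subgroup_center: "subgroup (center G) G"
proof (rule subgroupI)
  show "center G \<subseteq> carrier G" "center G \<noteq> {}"
    by (auto simp: center_def)
next
  fix a assume a: "a \<in> center G"
  show "inv a \<in> center G"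
    using a inv_comm unfolding center_def by blast
next
  fix a b assume ab: "a \<in> center G" "b \<in> center G"
  have "a \<otimes> b \<otimes> x = x \<otimes> (a \<otimes> b)" if "x \<in> carrier G" for x
    using that ab center_left_comm[OF ab(1) that] center_comm[OF ab(2) that]
    by (simp only: m_assoc center_closed)
  then show "a \<otimes> b \<in> center G"
    using ab m_closed unfolding center_def by blast
qed

lemma normal_center: "center G \<lhd> G"
  using subgroup_center by (rule normalI) (auto simp: r_coset_def l_coset_def center_def)

lemma commutator_closed [simp]:
  "x \<in> carrier G \<Longrightarrow> y \<in> carrier G \<Longrightarrow> commutator G x y \<in> carrier G"
  by (simp add: commutator_def)

text \<open>The commutator is the unique \<open>c\<close> with
  \<open>x \<otimes> y = c \<otimes> (y \<otimes> x)\<close>, so commutator identities can be proved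
  by reordering products instead of cancelling inverses.\<close>

lemma commutator_eqI:
  assumes "x \<in> carrier G" "y \<in> carrier G" "c \<in> carrier G" "x \<otimes> y = c \<otimes> (y \<otimes> x)"
  shows "commutator G x y = c"
proof -
  have "c \<otimes> (y \<otimes> x) \<otimes> inv (y \<otimes> x) = c"
    using assms(1-3) by (subst m_assoc) simp_all
  then show ?thesis by (simp only: commutator_def assms(4))
qed

lemma commutator_mult:
  "x \<in> carrier G \<Longrightarrow> y \<in> carrier G \<Longrightarrow> commutator G x y \<otimes> (y \<otimes> x) = x \<otimes> y"
  unfolding commutator_def by (subst m_assoc) simp_all

lemma commutator_eq_one_iff:
  "x \<in> carrier G \<Longrightarrow> y \<in> carrier G \<Longrightarrow> commutator G x y = \<one> \<longleftrightarrow> x \<otimes> y = y \<otimes> x"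
  using commutator_mult[of x y] commutator_eqI[of x y \<one>] by (metis l_one m_closed one_closed)

lemma mem_center_iff:
  "z \<in> center G \<longleftrightarrow> z \<in> carrier G \<and> (\<forall>x\<in>carrier G. commutator G z x = \<one>)"
  by (auto simp: center_def commutator_eq_one_iff)

text \<open>The cosets of \<open>x\<close> and \<open>y\<close> commute exactly when
  \<open>x \<otimes> y\<close> and \<open>y \<otimes> x\<close> lie in one coset, and the quotient
  of these two products is the commutator. This trades the quotient group in the definition of class
  2 for a condition on elements.\<close>

lemma comm_quotient_center_iff:
  "comm_group (G Mod center G) \<longleftrightarrow>
    (\<forall>x\<in>carrier G. \<forall>y\<in>carrier G. commutator G x y \<in> center G)"
proof -
  interpret Z: normal "center G" G by (rule normal_center)
  have *: "center G #> (x \<otimes> y) = center G #> (y \<otimes> x) \<longleftrightarrow> commutator G x y \<in> center G"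
    if "x \<in> carrier G" "y \<in> carrier G" for x y
    using that Z.rcos_eq_iff[of "x \<otimes> y" "y \<otimes> x"] by (simp add: commutator_def)
  show ?thesis
  proof
    assume "comm_group (G Mod center G)"
    then interpret Q: comm_group "G Mod center G" .
    show "\<forall>x\<in>carrier G. \<forall>y\<in>carrier G. commutator G x y \<in> center G"
    proof (intro ballI)
      fix x y assume xy: "x \<in> carrier G" "y \<in> carrier G"
      then have "center G #> x \<in> carrier (G Mod center G)" "center G #> y \<in> carrier (G Mod center G)"
        by (auto simp: FactGroup_def RCOSETS_def)
      from Q.m_comm[OF this] have "center G #> (x \<otimes> y) = center G #> (y \<otimes> x)"
        using xy by (simp add: Z.rcos_sum FactGroup_def)
      then show "commutator G x y \<in> center G" using * xy by simp
    qed
  next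
    assume c: "\<forall>x\<in>carrier G. \<forall>y\<in>carrier G. commutator G x y \<in> center G"
    show "comm_group (G Mod center G)"
    proof (rule group.group_comm_groupI[OF Z.factorgroup_is_group])
      fix X Y assume "X \<in> carrier (G Mod center G)" "Y \<in> carrier (G Mod center G)"
      then obtain x y where "x \<in> carrier G" "y \<in> carrier G" "X = center G #> x" "Y = center G #> y"
        by (auto simp: FactGroup_def RCOSETS_def)
      then show "X \<otimes>\<^bsub>G Mod center G\<^esub> Y = Y \<otimes>\<^bsub>G Mod center G\<^esub> X"
        using c * by (simp add: Z.rcos_sum FactGroup_def)
    qed
  qed
qed

end

section \<open>From groups to Lie rings\<close>

locale class2_group = group B for B :: "'a monoid" (structure) +
  assumes commutator_central:
      "x \<in> carrier B \<Longrightarrow> y \<in> carrier B \<Longrightarrow> commutator B x y \<in> center B"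
    and two_div: "two_divisible (center_group B)"
begin

sublocale Z: normal "center B" B by (rule normal_center)

abbreviation "k \<equiv> commutator B"
abbreviation "h \<equiv> halve (center_group B)"

lemma h_center [simp]: "a \<in> center B \<Longrightarrow> h a \<in> center B"
  using halve_closed(1)[OF two_div] by (simp add: center_group_def)

lemma h_carrier [simp]: "a \<in> center B \<Longrightarrow> h a \<in> carrier B"
  by (simp add: center_closed)

lemma h_double: "a \<in> center B \<Longrightarrow> h a \<otimes> h a = a"
  using halve_closed(2)[OF two_div] by (simp add: center_group_def)

lemma h_unique: "b \<in> center B \<Longrightarrow> b \<otimes> b = a \<Longrightarrow> h a = b"
  using halve_unique[OF two_div] by (simp add: center_group_def)

lemma h_mult:
  assumes "a \<in> center B" "b \<in> center B" shows "h (a \<otimes> b) = h a \<otimes> h b"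
proof (rule h_unique)
  show "h a \<otimes> h b \<in> center B" using assms by simp
  have "h a \<otimes> h b \<otimes> (h a \<otimes> h b) = (h a \<otimes> h a) \<otimes> (h b \<otimes> h b)"
    using assms by (simp add: m_assoc center_left_comm[of "h a" "h b"])
  then show "h a \<otimes> h b \<otimes> (h a \<otimes> h b) = a \<otimes> b"
    using assms by (simp add: h_double)
qed

lemma h_one [simp]: "h \<one> = \<one>"
  by (rule h_unique) simp_all

lemma h_inv:
  assumes "a \<in> center B" shows "h (inv a) = inv (h a)"
proof (rule h_unique)
  show "inv (h a) \<in> center B" using assms by simp
  show "inv (h a) \<otimes> inv (h a) = inv a"
    using assms by (simp flip: inv_mult_group add: h_double)
qed

lemma commutator_self [simp]: "x \<in> carrier B \<Longrightarrow> k x x = \<one>"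
  by (simp add: commutator_eq_one_iff)

lemma commutator_center_left [simp]: "z \<in> center B \<Longrightarrow> x \<in> carrier B \<Longrightarrow> k z x = \<one>"
  using mem_center_iff by blast

lemma commutator_center_right [simp]: "z \<in> center B \<Longrightarrow> x \<in> carrier B \<Longrightarrow> k x z = \<one>"
  by (simp add: commutator_eq_one_iff center_closed center_comm[of z x])

lemma commutator_swap:
  assumes "x \<in> carrier B" "y \<in> carrier B" shows "k y x = inv (k x y)"
  using assms by (simp add: commutator_def inv_mult_group)

text \<open>Moving \<open>z\<close> leftwards past \<open>y\<close> and then past \<open>x\<close>
  produces the factors \<open>k y z\<close> and \<open>k x z\<close>; in class 2 both are central
  and can be collected in front.\<close>

lemma commutator_mult_left:
  assumes "x \<in> carrier B" "y \<in> carrier B" "z \<in> carrier B"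
  shows "k (x \<otimes> y) z = k x z \<otimes> k y z"
proof (rule commutator_eqI)
  have "x \<otimes> y \<otimes> z = x \<otimes> (k y z \<otimes> (z \<otimes> y))"
    using assms by (simp add: commutator_mult m_assoc)
  also have "\<dots> = k y z \<otimes> (x \<otimes> z) \<otimes> y"
    using assms by (simp add: center_left_comm[of "k y z" x] commutator_central m_assoc)
  also have "\<dots> = k y z \<otimes> (k x z \<otimes> (z \<otimes> x)) \<otimes> y"
    using assms by (simp add: commutator_mult)
  also have "\<dots> = k x z \<otimes> k y z \<otimes> (z \<otimes> (x \<otimes> y))"
    using assms by (simp add: m_assoc center_left_comm[of "k x z" "k y z"] commutator_central)
  finally show "x \<otimes> y \<otimes> z = k x z \<otimes> k y z \<otimes> (z \<otimes> (x \<otimes> y))" .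
qed (use assms in auto)

lemma commutator_mult_right:
  assumes "x \<in> carrier B" "y \<in> carrier B" "z \<in> carrier B"
  shows "k z (x \<otimes> y) = k z x \<otimes> k z y"
proof -
  have "k z (x \<otimes> y) = inv (k x z \<otimes> k y z)"
    using assms by (simp only: commutator_swap[of "x \<otimes> y" z] commutator_mult_left m_closed)
  also have "\<dots> = inv (k y z \<otimes> k x z)"
    using assms by (simp only: center_comm commutator_central commutator_closed)
  also have "\<dots> = inv (k x z) \<otimes> inv (k y z)"
    using assms by (simp add: inv_mult_group)
  finally show ?thesis
    using assms by (simp only: commutator_swap[of x z] commutator_swap[of y z])
qed

lemma involution_eq_one:
  assumes "w \<in> carrier B" "w \<otimes> w = \<one>" shows "w = \<one>"
proof -
  \<comment> \<open>A central \<open>z\<close> with trivial square and \<open>\<one>\<close> are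
    both halves of \<open>\<one>\<close>, so uniqueness of halves identifies them.\<close>
  have cancel: "z = \<one>" if "z \<in> center B" "z \<otimes> z = \<one>" for z
    by (rule trans[OF h_unique[OF that, symmetric] h_one])
  have "k w y = \<one>" if "y \<in> carrier B" for y
  proof (rule cancel)
    show "k w y \<otimes> k w y = \<one>"
      using assms that by (simp flip: commutator_mult_left)
  qed (use assms that commutator_central in simp)
  then have "w \<in> center B" using assms(1) mem_center_iff by blast
  then show ?thesis using assms(2) by (rule cancel)
qed

definition add where "add x y = x \<otimes> y \<otimes> inv (h (k x y))"

text \<open>With \<open>x = a \<otimes> s1\<close> and \<open>y = b \<otimes> s2\<close>, the
  commutator of \<open>x\<close> and \<open>y\<close> is \<open>p \<otimes> inv q\<close>, and the
  symmetrized cocycle \<open>h (p \<otimes> q)\<close> is \<open>p\<close> divided by half of it.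
  Hence the section drops out of both formulas.\<close>

lemma L_wrt_eq:
  assumes s: "is_section B (center B) s" and x: "x \<in> carrier B" and y: "y \<in> carrier B"
  shows "ladd (L_wrt B s) x y = add x y" and "lbracket (L_wrt B s) x y = k x y"
proof -
  let ?c = "\<lambda>x. center B #> x"
  define a b p q where "a = sub_coord B (center B) s x" and "b = sub_coord B (center B) s y"
    and "p = section_cocycle B (center B) s (?c x) (?c y)"
    and "q = section_cocycle B (center B) s (?c y) (?c x)"
  define s1 s2 t where "s1 = s (?c x)" and "s2 = s (?c y)" and "t = s (?c (x \<otimes> y))"
  have Z: "a \<in> center B" "b \<in> center B" "p \<in> center B" "q \<in> center B"
    using Z.sub_coord_mem(1)[OF s] Z.section_cocycle_mem(1)[OF s] x y
    by (auto simp: a_def b_def p_def q_def)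
  note [simp] = Z Z[THEN center_closed]
  have [simp]: "s1 \<in> carrier B" "s2 \<in> carrier B" "t \<in> carrier B"
    using Z.section_coset(1)[OF s] x y by (auto simp: s1_def s2_def t_def)
  \<comment> \<open>Class 2 makes the same representative \<open>t\<close> occur in both
    factorizations \<open>pe\<close> and \<open>qe\<close> below.\<close>
  have c: "?c (x \<otimes> y) = ?c (y \<otimes> x)"
    using x y commutator_central[of x y] Z.rcos_eq_iff[of "x \<otimes> y" "y \<otimes> x"] by (simp add: commutator_def)
  have xe: "x = a \<otimes> s1" and ye: "y = b \<otimes> s2" and pe: "s1 \<otimes> s2 = p \<otimes> t" and qe: "s2 \<otimes> s1 = q \<otimes> t"
    using Z.sub_coord_mem(2)[OF s] Z.section_cocycle_mem(2)[OF s] x y c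
    by (auto simp: a_def b_def p_def q_def s1_def s2_def t_def)
  have "k s1 s2 = p \<otimes> inv q"
    proof (rule commutator_eqI)
    have "inv q \<otimes> (q \<otimes> t) = t" by (subst m_assoc[symmetric]) simp_all
    then show "s1 \<otimes> s2 = p \<otimes> inv q \<otimes> (s2 \<otimes> s1)" by (simp add: pe qe m_assoc)
  qed simp_all
  \<comment> \<open>The central coordinates \<open>a\<close> and \<open>b\<close> contribute trivial
    commutators, so only \<open>k s1 s2\<close> survives.\<close>
  then have k: "k x y = p \<otimes> inv q"
    by (simp add: xe ye commutator_mult_left commutator_mult_right)
  show "lbracket (L_wrt B s) x y = k x y"
    using x y by (simp add: L_wrt_def L_eta_def quot_coord_def Let_def k flip: p_def q_def)
  have "ladd (L_wrt B s) x y = a \<otimes> b \<otimes> h (p \<otimes> q) \<otimes> t"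
    using x y by (simp add: L_wrt_def L_phi_def quot_coord_def from_coords_def FactGroup_def
      Z.rcos_sum Let_def flip: p_def q_def a_def b_def t_def)
  also have "\<dots> = a \<otimes> b \<otimes> (h p \<otimes> h q) \<otimes> t"
    by (simp add: h_mult)
  also have "\<dots> = a \<otimes> b \<otimes> (p \<otimes> t) \<otimes> inv (h (p \<otimes> inv q))"
  proof -
    have "h (p \<otimes> inv q) = h p \<otimes> inv (h q)" by (simp add: h_mult h_inv)
    \<comment> \<open>Once \<open>p\<close> is split as \<open>h p \<otimes> h p\<close>, dividing
      by \<open>h p \<otimes> inv (h q)\<close> cancels one \<open>h p\<close> and brings in
      \<open>h q\<close>.\<close>
    then have "p \<otimes> inv (h (p \<otimes> inv q)) = (h p \<otimes> h p) \<otimes> (h q \<otimes> inv (h p))"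
      by (simp add: inv_mult_group h_double)
    also have "\<dots> = h p \<otimes> h q"
      using center_left_comm[of "h q" "h p" "inv (h p)"] center_comm[of "h q" "h p"]
      by (simp add: m_assoc)
    finally have *: "p \<otimes> inv (h (p \<otimes> inv q)) = h p \<otimes> h q" .
    have "t \<otimes> inv (h (p \<otimes> inv q)) = inv (h (p \<otimes> inv q)) \<otimes> t"
      by (rule center_comm) auto
    then have "a \<otimes> b \<otimes> (p \<otimes> t) \<otimes> inv (h (p \<otimes> inv q)) = a \<otimes> b \<otimes> (p \<otimes> inv (h (p \<otimes> inv q))) \<otimes> t"
      by (simp add: m_assoc)
    then show ?thesis using * by simp
  qed
  also have "a \<otimes> b \<otimes> (p \<otimes> t) = x \<otimes> y"
    by (simp add: xe ye m_assoc center_left_comm[of b s1] flip: pe)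
  finally show "ladd (L_wrt B s) x y = add x y"
    by (simp add: add_def k)
qed

lemma L_obj_eq:
  "L_obj B = \<lparr>lcarrier = carrier B, ladd = (\<lambda>x\<in>carrier B. \<lambda>y\<in>carrier B. add x y), lzero = \<one>,
     lbracket = (\<lambda>x\<in>carrier B. \<lambda>y\<in>carrier B. k x y)\<rparr>"
proof -
  let ?L = "L_wrt B (SOME s. is_section B (center B) s)"
  \<comment> \<open>The operations of \<open>L_wrt\<close> are restricted functions, so they equal
    their own restrictions and only values on the carrier remain to be compared.\<close>
  have "ladd ?L = (\<lambda>x\<in>carrier B. \<lambda>y\<in>carrier B. ladd ?L x y)"
    "lbracket ?L = (\<lambda>x\<in>carrier B. \<lambda>y\<in>carrier B. lbracket ?L x y)"
    by (auto simp: L_wrt_def Let_def fun_eq_iff)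
  then have "ladd ?L = (\<lambda>x\<in>carrier B. \<lambda>y\<in>carrier B. add x y)"
    "lbracket ?L = (\<lambda>x\<in>carrier B. \<lambda>y\<in>carrier B. k x y)"
    by (simp_all add: L_wrt_eq[OF Z.is_section_some] cong: restrict_cong)
  then show ?thesis
    unfolding L_obj_def by (intro lie.equality) (simp_all add: L_wrt_def Let_def)
qed

lemma L_obj_simps [simp]:
  "lcarrier (L_obj B) = carrier B"
  "lzero (L_obj B) = \<one>"
  "x \<in> carrier B \<Longrightarrow> y \<in> carrier B \<Longrightarrow> ladd (L_obj B) x y = add x y"
  "x \<in> carrier B \<Longrightarrow> y \<in> carrier B \<Longrightarrow> lbracket (L_obj B) x y = k x y"
  by (simp_all add: L_obj_eq)

section \<open>The Lie ring axioms for L(B)\<close>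

definition corr where "corr x y = inv (h (k x y))"

lemma add_corr: "add x y = x \<otimes> y \<otimes> corr x y"
  by (simp add: add_def corr_def)

lemma corr_center [simp]: "x \<in> carrier B \<Longrightarrow> y \<in> carrier B \<Longrightarrow> corr x y \<in> center B"
  by (simp add: corr_def commutator_central)

lemma corr_carrier [simp]: "x \<in> carrier B \<Longrightarrow> y \<in> carrier B \<Longrightarrow> corr x y \<in> carrier B"
  by (simp add: center_closed)

lemma corr_trivial [simp]:
  "x \<in> carrier B \<Longrightarrow> corr x x = \<one>"
  "z \<in> center B \<Longrightarrow> x \<in> carrier B \<Longrightarrow> corr z x = \<one>"
  "z \<in> center B \<Longrightarrow> x \<in> carrier B \<Longrightarrow> corr x z = \<one>"
  by (simp_all add: corr_def)

text \<open>The commutator is bimultiplicative, and halving and inversion are endomorphisms of the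
  abelian center. So \<open>corr\<close> is a bimultiplicative map into the center, in particular a
  2-cocycle, which is why twisting the product by it stays associative.\<close>

lemma corr_mult:
  assumes "x \<in> carrier B" "y \<in> carrier B" "z \<in> carrier B"
  shows "corr (x \<otimes> y) z = corr x z \<otimes> corr y z" "corr z (x \<otimes> y) = corr z x \<otimes> corr z y"
  using assms
  by (simp_all add: corr_def commutator_mult_left commutator_mult_right commutator_central
      center_closed flip: h_inv)
    (simp_all add: inv_mult_group h_mult h_inv commutator_central center_comm[of "inv (h (k y z))" "inv (h (k x z))"]
       center_comm[of "inv (h (k z y))" "inv (h (k z x))"])

lemma add_closed [simp]: "x \<in> carrier B \<Longrightarrow> y \<in> carrier B \<Longrightarrow> add x y \<in> carrier B"
  by (simp add: add_corr)

text \<open>The correction vanishes at a central argument, so sum and product coincide on the center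
  and halving there means the same for both structures.\<close>

lemma add_center:
  assumes "z \<in> center B" "x \<in> carrier B"
  shows "add z x = z \<otimes> x" "add x z = x \<otimes> z"
  using assms by (simp_all add: add_corr)

lemma add_assoc:
  assumes "x \<in> carrier B" "y \<in> carrier B" "z \<in> carrier B"
  shows "add (add x y) z = add x (add y z)"
proof -
  \<comment> \<open>\<open>corr x y\<close> is central, so it contributes nothing inside a further
    correction term.\<close>
  have "add (add x y) z = x \<otimes> y \<otimes> corr x y \<otimes> z \<otimes> (corr x z \<otimes> corr y z)"
    using assms by (simp add: add_corr corr_mult)
  also have "\<dots> = x \<otimes> y \<otimes> z \<otimes> corr x y \<otimes> (corr x z \<otimes> corr y z)"
    using assms center_comm[of "corr x y" z] by (simp add: m_assoc)
  also have "\<dots> = x \<otimes> y \<otimes> z \<otimes> (corr x y \<otimes> (corr x z \<otimes> corr y z))"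
    using assms by (simp add: m_assoc)
  also have "corr x y \<otimes> (corr x z \<otimes> corr y z) = corr y z \<otimes> (corr x y \<otimes> corr x z)"
    using assms center_comm[of "corr y z" "corr x y \<otimes> corr x z"] by (simp add: m_assoc)
  also have "x \<otimes> y \<otimes> z \<otimes> (corr y z \<otimes> (corr x y \<otimes> corr x z)) = add x (add y z)"
    using assms by (simp add: add_corr corr_mult m_assoc)
  finally show ?thesis .
qed

lemma add_comm:
  assumes "x \<in> carrier B" "y \<in> carrier B"
  shows "add x y = add y x"
proof -
  let ?a = "h (k x y)"
  have [simp]: "?a \<in> center B" "k x y \<in> center B" using assms by (simp_all add: commutator_central)
  \<comment> \<open>The commutator is split into two halves. Removing one of them leaves
    \<open>y \<otimes> x \<otimes> ?a\<close>, the midpoint between \<open>y \<otimes> x\<close> and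
    \<open>x \<otimes> y\<close>, which is symmetric in \<open>x\<close> and
    \<open>y\<close>.\<close>
  have "x \<otimes> y = ?a \<otimes> (?a \<otimes> (y \<otimes> x))"
    using assms commutator_mult[of x y] h_double[of "k x y"] by (simp flip: m_assoc)
  also have "\<dots> = y \<otimes> x \<otimes> ?a \<otimes> ?a"
    using assms by (simp add: center_comm[of ?a "y \<otimes> x"] center_comm[of ?a "?a \<otimes> (y \<otimes> x)"])
  finally have "add x y = y \<otimes> x \<otimes> ?a"
    using assms by (simp add: add_def m_assoc)
  then show ?thesis
    using assms by (simp add: add_def commutator_swap[of x y] h_inv)
qed

lemma commutator_add:
  assumes "x \<in> carrier B" "y \<in> carrier B" "z \<in> carrier B"
  shows "k (add x y) z = k x z \<otimes> k y z" "k z (add x y) = k z x \<otimes> k z y"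
  using assms by (simp_all add: add_corr commutator_mult_left commutator_mult_right)

lemma comm_group_L: "comm_group (add_group (L_obj B))"
proof (rule comm_groupI)
  fix x assume "x \<in> carrier (add_group (L_obj B))"
  then show "\<exists>y\<in>carrier (add_group (L_obj B)). y \<otimes>\<^bsub>add_group (L_obj B)\<^esub> x = \<one>\<^bsub>add_group (L_obj B)\<^esub>"
    \<comment> \<open>The group inverse is also the negative: it commutes with \<open>x\<close>, so
      the correction is trivial.\<close>
    using commutator_eq_one_iff[of "inv x" x]
    by (intro bexI[of _ "inv x"]) (simp_all add: add_group_def add_def)
qed (auto simp: add_group_def add_assoc add_center intro: add_comm)

text \<open>Commutators are central, so sums of brackets are products and biadditivity is
  \<open>commutator_add\<close>. In the Jacobi identity each inner bracket is central, hence all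
  three terms vanish.\<close>

lemma lie_ring_L: "lie_ring (L_obj B)"
  using comm_group_L
  by (simp add: lie_ring_def commutator_add commutator_central add_center)

lemma lie_center_L [simp]: "lie_center (L_obj B) = center B"
  unfolding set_eq_iff mem_center_iff by (auto simp: lie_center_def)

lemma two_divisible_L: "two_divisible (lie_center_group (L_obj B))"
  by (rule two_divisible_cong[OF two_div])
    (simp_all add: lie_center_group_def center_group_def add_group_def add_center center_closed)

lemma halve_L [simp]:
  assumes "a \<in> center B"
  shows "halve (lie_center_group (L_obj B)) a = h a"
  using assms
  by (intro halve_unique[OF two_divisible_L])
    (simp_all add: lie_center_group_def add_group_def add_center h_double)

end

section \<open>From Lie rings to groups\<close>

lemma add_group_simps:
  "carrier (add_group R) = lcarrier R" "mult (add_group R) = ladd R" "one (add_group R) = lzero R"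
  by (simp_all add: add_group_def)

lemma subgroup_lie_center:
  assumes "lie_ring R"
  shows "subgroup (lie_center R) (add_group R)"
proof -
  interpret comm_group "add_group R"
    rewrites "carrier (add_group R) = lcarrier R" and "mult (add_group R) = ladd R" and "one (add_group R) = lzero R"
    using assms by (simp_all add: lie_ring_def add_group_simps)
  have add: "lbracket R (ladd R x y) z = ladd R (lbracket R x z) (lbracket R y z)"
    and cl: "lbracket R x z \<in> lcarrier R"
    if "x \<in> lcarrier R" "y \<in> lcarrier R" "z \<in> lcarrier R" for x y z
    using assms that by (simp_all add: lie_ring_def)
  have zero: "lbracket R (lzero R) x = lzero R" if "x \<in> lcarrier R" for x
    using add[of "lzero R" "lzero R" x] cl[of "lzero R" "lzero R" x] that by simp
  show ?thesis
  proof (rule subgroupI)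
    fix a assume "a \<in> lie_center R"
    then have a: "a \<in> lcarrier R" "\<And>x. x \<in> lcarrier R \<Longrightarrow> lbracket R a x = lzero R"
      by (auto simp: lie_center_def)
    have "lbracket R (inv\<^bsub>add_group R\<^esub> a) x = lzero R" if "x \<in> lcarrier R" for x
      using add[of "inv\<^bsub>add_group R\<^esub> a" a x] that a zero cl[of "inv\<^bsub>add_group R\<^esub> a" a x] by simp
    then show "inv\<^bsub>add_group R\<^esub> a \<in> lie_center R"
      using a by (simp add: lie_center_def)
  qed (auto simp: lie_center_def add zero)
qed

text \<open>The zero of the quotient is \<open>lie_center R\<close> itself, and the bracket of two
  cosets is the union of the cosets of all brackets of representatives. Both directions compare
  these sets directly, using that each element lies in its own coset.\<close>

lemma lie_class2_iff:
  "lie_class2 R \<longleftrightarrow>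
    lie_ring R \<and> (\<forall>x\<in>lcarrier R. \<forall>y\<in>lcarrier R. lbracket R x y \<in> lie_center R)"
proof (cases "lie_ring R")
  case True
  interpret comm_group "add_group R"
    rewrites "carrier (add_group R) = lcarrier R" and "mult (add_group R) = ladd R" and "one (add_group R) = lzero R"
    using True by (simp_all add: lie_ring_def add_group_simps)
  interpret Z: subgroup "lie_center R" "add_group R"
    rewrites "carrier (add_group R) = lcarrier R" and "mult (add_group R) = ladd R" and "one (add_group R) = lzero R"
    using True by (simp_all add: subgroup_lie_center add_group_simps)
  let ?I = "lie_center R"
  let ?c = "\<lambda>x. ?I #>\<^bsub>add_group R\<^esub> x"
  have cosets: "carrier (add_group R Mod ?I) = ?c ` lcarrier R"
    by (auto simp: FactGroup_def RCOSETS_def add_group_simps)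
  have sub: "?c x \<subseteq> lcarrier R" and self: "x \<in> ?c x" if "x \<in> lcarrier R" for x
    using that r_coset_subset_G[OF Z.subset] rcos_self[OF that subgroup_lie_center[OF True]] by auto
  have cl: "lbracket R x y \<in> lcarrier R" if "x \<in> lcarrier R" "y \<in> lcarrier R" for x y
    using True that by (simp add: lie_ring_def)
  have coset_I: "?c b = ?I \<longleftrightarrow> b \<in> ?I" if "b \<in> lcarrier R" for b
    using self[OF that] coset_join2[OF that subgroup_lie_center[OF True]] by auto
  have "lie_commutative (lie_quotient R ?I) \<longleftrightarrow>
      (\<forall>x\<in>lcarrier R. \<forall>y\<in>lcarrier R. (\<Union>x'\<in>?c x. \<Union>y'\<in>?c y. ?c (lbracket R x' y')) = ?I)"
    by (simp add: lie_commutative_def lie_quotient_def cosets)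
  also have "\<dots> \<longleftrightarrow> (\<forall>x\<in>lcarrier R. \<forall>y\<in>lcarrier R. lbracket R x y \<in> ?I)"
  proof (intro iffI ballI)
    fix x y assume *: "\<forall>x\<in>lcarrier R. \<forall>y\<in>lcarrier R. (\<Union>x'\<in>?c x. \<Union>y'\<in>?c y. ?c (lbracket R x' y')) = ?I"
      and xy: "x \<in> lcarrier R" "y \<in> lcarrier R"
    then show "lbracket R x y \<in> ?I"
      using self[OF xy(1)] self[OF xy(2)] self[OF cl[OF xy]] by blast
  next
    fix x y assume *: "\<forall>x\<in>lcarrier R. \<forall>y\<in>lcarrier R. lbracket R x y \<in> ?I"
      and xy: "x \<in> lcarrier R" "y \<in> lcarrier R"
    then have "?c (lbracket R x' y') = ?I" if "x' \<in> ?c x" "y' \<in> ?c y" for x' y'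
      using that sub[OF xy(1)] sub[OF xy(2)] coset_I cl by blast
    then have "(\<Union>x'\<in>?c x. \<Union>y'\<in>?c y. ?c (lbracket R x' y')) = (\<Union>x'\<in>?c x. \<Union>y'\<in>?c y. ?I)"
      by (intro SUP_cong refl)
    \<comment> \<open>The union of a constant family is that constant only over nonempty index sets;
      \<open>x\<close> and \<open>y\<close> show that the two cosets are nonempty.\<close>
    also have "\<dots> = ?I"
      using self[OF xy(1)] self[OF xy(2)] by blast
    finally show "(\<Union>x'\<in>?c x. \<Union>y'\<in>?c y. ?c (lbracket R x' y')) = ?I" .
  qed
  finally show ?thesis
    using True by (simp add: lie_class2_def)
qed (simp add: lie_class2_def)

locale class2_lie =
  fixes R :: "'a lie"
  assumes lie: "lie_ring R"
    and bracket_central: "x \<in> lcarrier R \<Longrightarrow> y \<in> lcarrier R \<Longrightarrow> lbracket R x y \<in> lie_center R"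
    and two_div: "two_divisible (lie_center_group R)"
begin

text \<open>The rewrites state the inherited group facts in terms of \<open>lcarrier\<close>,
  \<open>ladd\<close> and \<open>lzero\<close>, so that they apply to Lie ring expressions without
  unfolding \<open>add_group\<close>.\<close>

sublocale comm_group "add_group R"
  rewrites "carrier (add_group R) = lcarrier R" and "mult (add_group R) = ladd R" and "one (add_group R) = lzero R"
  using lie by (simp_all add: lie_ring_def add_group_simps)

sublocale Z: subgroup "lie_center R" "add_group R"
  rewrites "carrier (add_group R) = lcarrier R" and "mult (add_group R) = ladd R" and "one (add_group R) = lzero R"
  using lie by (simp_all add: subgroup_lie_center add_group_simps)

abbreviation plus (infixl "\<oplus>" 65) where "x \<oplus> y \<equiv> ladd R x y"
abbreviation neg where "neg x \<equiv> inv\<^bsub>add_group R\<^esub> x"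
abbreviation "br \<equiv> lbracket R"
abbreviation "h \<equiv> halve (lie_center_group R)"

section \<open>Bracket calculus and halving in the center\<close>

lemma br_closed [simp]: "x \<in> lcarrier R \<Longrightarrow> y \<in> lcarrier R \<Longrightarrow> br x y \<in> lcarrier R"
  using lie by (simp add: lie_ring_def)

lemma br_add:
  assumes "x \<in> lcarrier R" "y \<in> lcarrier R" "z \<in> lcarrier R"
  shows "br (x \<oplus> y) z = br x z \<oplus> br y z" "br z (x \<oplus> y) = br z x \<oplus> br z y"
  using lie assms by (simp_all add: lie_ring_def)

lemma br_self [simp]: "x \<in> lcarrier R \<Longrightarrow> br x x = lzero R"
  using lie by (simp add: lie_ring_def)

lemma br_center_left [simp]: "z \<in> lie_center R \<Longrightarrow> x \<in> lcarrier R \<Longrightarrow> br z x = lzero R"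
  unfolding lie_center_def by blast

text \<open>Polarization: expanding the vanishing bracket of \<open>x \<oplus> y\<close> with itself
  leaves only the mixed terms.\<close>

lemma br_swap:
  assumes "x \<in> lcarrier R" "y \<in> lcarrier R"
  shows "br x y \<oplus> br y x = lzero R"
proof -
  have "lzero R = br (x \<oplus> y) (x \<oplus> y)"
    using assms by simp
  also have "\<dots> = br x (x \<oplus> y) \<oplus> br y (x \<oplus> y)"
    using assms by (simp only: br_add(1) m_closed)
  also have "\<dots> = br x y \<oplus> br y x"
    using assms by (simp add: br_add(2))
  finally show ?thesis by simp
qed

lemma br_center_right [simp]: "z \<in> lie_center R \<Longrightarrow> x \<in> lcarrier R \<Longrightarrow> br x z = lzero R"
  using br_swap[of z x] by simp

lemma h_center [simp]: "a \<in> lie_center R \<Longrightarrow> h a \<in> lie_center R"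
  using halve_closed(1)[OF two_div] by (simp add: lie_center_group_def)

lemma h_double: "a \<in> lie_center R \<Longrightarrow> h a \<oplus> h a = a"
  using halve_closed(2)[OF two_div] by (simp add: lie_center_group_def add_group_def)

lemma h_unique: "b \<in> lie_center R \<Longrightarrow> b \<oplus> b = a \<Longrightarrow> h a = b"
  using halve_unique[OF two_div] by (simp add: lie_center_group_def add_group_def)

lemma h_add:
  assumes "a \<in> lie_center R" "b \<in> lie_center R" shows "h (a \<oplus> b) = h a \<oplus> h b"
proof (rule h_unique)
  show "h a \<oplus> h b \<in> lie_center R" using assms by simp
  have "h a \<oplus> h b \<oplus> (h a \<oplus> h b) = (h a \<oplus> h a) \<oplus> (h b \<oplus> h b)"
    using assms by (simp add: m_ac)
  then show "h a \<oplus> h b \<oplus> (h a \<oplus> h b) = a \<oplus> b"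
    using assms by (simp add: h_double)
qed

lemma h_zero [simp]: "h (lzero R) = lzero R"
  by (rule h_unique) simp_all

lemma involution_eq_zero:
  assumes "w \<in> lcarrier R" "w \<oplus> w = lzero R" shows "w = lzero R"
proof -
  have cancel: "z = lzero R" if "z \<in> lie_center R" "z \<oplus> z = lzero R" for z
    by (rule trans[OF h_unique[OF that, symmetric] h_zero])
  have "br w y = lzero R" if "y \<in> lcarrier R" for y
  proof (rule cancel)
    show "br w y \<oplus> br w y = lzero R"
      using assms that br_add(1)[of w w y] by simp
  qed (use assms that bracket_central in simp)
  then have "w \<in> lie_center R" using assms(1) unfolding lie_center_def by blast
  then show ?thesis using assms(2) by (rule cancel)
qed

section \<open>The product formula and the group axioms for E(R)\<close>

definition mul where "mul x y = x \<oplus> y \<oplus> h (br x y)"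

text \<open>Central coordinates drop out of the bracket, so \<open>E_eta\<close> is
  \<open>br x y\<close>. The part \<open>E_phi\<close> of the cocycle only restores the sum of the
  two representatives, which leaves \<open>x \<oplus> y\<close> plus half the bracket.\<close>

lemma E_wrt_eq:
  assumes s: "is_section (add_group R) (lie_center R) s"
    and x: "x \<in> lcarrier R" and y: "y \<in> lcarrier R"
  shows "mult (E_wrt R s) x y = mul x y"
proof -
  interpret N: normal "lie_center R" "add_group R"
    using subgroup_lie_center[OF lie] subgroup_imp_normal by blast
  have [simp]: "carrier (add_group R) = lcarrier R" "mult (add_group R) = ladd R" "one (add_group R) = lzero R"
    by (simp_all add: add_group_simps)
  let ?c = "\<lambda>x. lie_center R #>\<^bsub>add_group R\<^esub> x"
  define a b p where "a = sub_coord (add_group R) (lie_center R) s x"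
    and "b = sub_coord (add_group R) (lie_center R) s y"
    and "p = section_cocycle (add_group R) (lie_center R) s (?c x) (?c y)"
  define s1 s2 t where "s1 = s (?c x)" and "s2 = s (?c y)" and "t = s (?c (x \<oplus> y))"
  have Z [simp]: "a \<in> lie_center R" "b \<in> lie_center R" "p \<in> lie_center R"
    using N.sub_coord_mem(1)[OF s] N.section_cocycle_mem(1)[OF s] x y
    by (auto simp: a_def b_def p_def)
  have S [simp]: "s1 \<in> lcarrier R" "s2 \<in> lcarrier R" "t \<in> lcarrier R"
    using N.section_coset(1)[OF s] x y by (auto simp: s1_def s2_def t_def)
  have xe: "x = a \<oplus> s1" and ye: "y = b \<oplus> s2" and pe: "s1 \<oplus> s2 = p \<oplus> t"
    using N.sub_coord_mem(2)[OF s] N.section_cocycle_mem(2)[OF s] x y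
    by (auto simp: a_def b_def p_def s1_def s2_def t_def)
  have br: "br x y = br s1 s2"
    by (simp add: xe ye br_add)
  have hc [simp]: "h (br x y) \<in> lcarrier R"
    using x y by (simp add: bracket_central)
  have "mult (E_wrt R s) x y = a \<oplus> b \<oplus> (p \<oplus> h (br x y)) \<oplus> t"
    using x y N.rcos_sum[of x y] by (simp add: E_wrt_def E_phi_def E_psi_def E_eta_def lie_quotient_def
      quot_coord_def from_coords_def FactGroup_def br
      Let_def flip: p_def a_def b_def t_def s1_def s2_def)
  also have "\<dots> = a \<oplus> b \<oplus> (p \<oplus> t) \<oplus> h (br x y)"
    by (simp add: m_ac)
  also have "a \<oplus> b \<oplus> (p \<oplus> t) = x \<oplus> y"
    by (simp add: xe ye m_ac flip: pe)
  finally show ?thesis by (simp add: mul_def)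
qed

lemma E_obj_eq:
  "E_obj R = \<lparr>carrier = lcarrier R, mult = (\<lambda>x\<in>lcarrier R. \<lambda>y\<in>lcarrier R. mul x y), one = lzero R\<rparr>"
proof -
  interpret N: normal "lie_center R" "add_group R"
    using subgroup_lie_center[OF lie] subgroup_imp_normal by blast
  let ?E = "E_wrt R (SOME s. is_section (add_group R) (lie_center R) s)"
  have "mult ?E = (\<lambda>x\<in>lcarrier R. \<lambda>y\<in>lcarrier R. mult ?E x y)"
    by (auto simp: E_wrt_def Let_def fun_eq_iff)
  then have "mult ?E = (\<lambda>x\<in>lcarrier R. \<lambda>y\<in>lcarrier R. mul x y)"
    by (simp add: E_wrt_eq[OF N.is_section_some] cong: restrict_cong)
  then show ?thesis
    unfolding E_obj_def by (intro monoid.equality) (simp_all add: E_wrt_def Let_def)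
qed

lemma E_obj_simps [simp]:
  "carrier (E_obj R) = lcarrier R"
  "one (E_obj R) = lzero R"
  "x \<in> lcarrier R \<Longrightarrow> y \<in> lcarrier R \<Longrightarrow> mult (E_obj R) x y = mul x y"
  by (simp_all add: E_obj_eq)

lemma hbr_center [simp]: "x \<in> lcarrier R \<Longrightarrow> y \<in> lcarrier R \<Longrightarrow> h (br x y) \<in> lie_center R"
  by (simp add: bracket_central)

lemma mul_closed [simp]: "x \<in> lcarrier R \<Longrightarrow> y \<in> lcarrier R \<Longrightarrow> mul x y \<in> lcarrier R"
  by (simp add: mul_def)

lemma mul_center:
  assumes "z \<in> lie_center R" "x \<in> lcarrier R"
  shows "mul z x = z \<oplus> x" "mul x z = x \<oplus> z"
  using assms by (simp_all add: mul_def)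

lemma br_mul:
  assumes "x \<in> lcarrier R" "y \<in> lcarrier R" "z \<in> lcarrier R"
  shows "br (mul x y) z = br x z \<oplus> br y z" "br z (mul x y) = br z x \<oplus> br z y"
  using assms by (simp_all add: mul_def br_add)

text \<open>Half the bracket is biadditive with central values, so it drops out of further brackets.
  Both sides become the sum of \<open>x\<close>, \<open>y\<close>, \<open>z\<close> and half of each
  of the three pairwise brackets.\<close>

lemma mul_assoc:
  assumes "x \<in> lcarrier R" "y \<in> lcarrier R" "z \<in> lcarrier R"
  shows "mul (mul x y) z = mul x (mul y z)"
proof -
  have "mul (mul x y) z = x \<oplus> y \<oplus> h (br x y) \<oplus> z \<oplus> (h (br x z) \<oplus> h (br y z))"
    using assms by (simp add: mul_def[of "mul x y"] br_mul h_add bracket_central) (simp add: mul_def)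
  also have "\<dots> = x \<oplus> (y \<oplus> z \<oplus> h (br y z)) \<oplus> (h (br x y) \<oplus> h (br x z))"
    using assms by (simp add: m_ac)
  also have "\<dots> = mul x (mul y z)"
    using assms by (simp add: mul_def[of x "mul y z"] br_mul h_add bracket_central) (simp add: mul_def)
  finally show ?thesis .
qed

lemma group_E: "group (E_obj R)"
proof (rule groupI)
  fix x assume x: "x \<in> carrier (E_obj R)"
  \<comment> \<open>For \<open>neg x\<close> to invert \<open>x\<close> under \<open>mul\<close>,
    its bracket with \<open>x\<close> must vanish. Since \<open>br x x\<close> is zero, that bracket
    equals \<open>br (neg x \<oplus> x) x\<close>, a bracket with zero.\<close>
  have "br (neg x \<oplus> x) x = br (neg x) x"
    using x by (simp only: E_obj_simps br_add inv_closed br_self br_closed r_one)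
  then have "br (neg x) x = lzero R"
    using x by simp
  then show "\<exists>y\<in>carrier (E_obj R). y \<otimes>\<^bsub>E_obj R\<^esub> x = \<one>\<^bsub>E_obj R\<^esub>"
    using x by (intro bexI[of _ "neg x"]) (simp_all add: mul_def)
qed (simp_all add: mul_assoc mul_center)

sublocale E: group "E_obj R" by (rule group_E)

text \<open>The corrections in \<open>mul x y\<close> and \<open>mul y x\<close> are
  \<open>h (br x y)\<close> and its negative, which differ by the full bracket. Centers and halving
  therefore agree for \<open>R\<close> and \<open>E_obj R\<close>.\<close>

lemma commutator_E:
  assumes "x \<in> lcarrier R" "y \<in> lcarrier R"
  shows "commutator (E_obj R) x y = br x y"
proof (rule E.commutator_eqI)
  have "br x y \<oplus> h (br y x) = h (br x y) \<oplus> (h (br x y) \<oplus> h (br y x))"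
    using assms h_double[of "br x y"] by (simp add: bracket_central flip: m_assoc)
  also have "h (br x y) \<oplus> h (br y x) = lzero R"
    using assms by (simp add: bracket_central br_swap flip: h_add)
  finally have *: "br x y \<oplus> h (br y x) = h (br x y)"
    using assms by simp
  have "mul x y = (y \<oplus> x) \<oplus> (br x y \<oplus> h (br y x))"
    using assms by (simp add: mul_def * m_comm)
  also have "\<dots> = br x y \<oplus> mul y x"
    using assms by (simp add: mul_def m_ac)
  also have "\<dots> = mul (br x y) (mul y x)"
    using assms by (simp add: mul_center bracket_central)
  finally show "x \<otimes>\<^bsub>E_obj R\<^esub> y = br x y \<otimes>\<^bsub>E_obj R\<^esub> (y \<otimes>\<^bsub>E_obj R\<^esub> x)"
    using assms by simp
qed (use assms in simp_all)

lemma center_E [simp]: "center (E_obj R) = lie_center R"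
  unfolding set_eq_iff E.mem_center_iff lie_center_def by (auto simp: commutator_E)

lemma two_divisible_E: "two_divisible (center_group (E_obj R))"
  by (rule two_divisible_cong[OF two_div])
    (simp_all add: lie_center_group_def center_group_def add_group_def mul_center)

lemma class2_group_E: "class2_group (E_obj R)"
  by unfold_locales (simp_all add: commutator_E bracket_central two_divisible_E)

lemma halve_E [simp]:
  assumes "a \<in> lie_center R"
  shows "halve (center_group (E_obj R)) a = h a"
  using assms
  by (intro halve_unique[OF two_divisible_E]) (simp_all add: center_group_def mul_center h_double)

end

section \<open>The two constructions are inverse and functorial\<close>

lemma (in class2_group) class2_lie_L: "class2_lie (L_obj B)"
  by unfold_locales (simp_all add: lie_ring_L commutator_central two_divisible_L)

text \<open>Bracket and halving in \<open>L_obj B\<close> are \<open>k\<close> and \<open>h\<close>,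
  so \<open>E_obj\<close> puts back exactly the half commutator that \<open>add\<close> removed.
  Extensionality of the product settles arguments outside the carrier.\<close>

lemma (in class2_group) E_L:
  assumes "mult B \<in> carrier B \<rightarrow>\<^sub>E carrier B \<rightarrow>\<^sub>E carrier B"
  shows "E_obj (L_obj B) = B"
proof -
  interpret L: class2_lie "L_obj B" by (rule class2_lie_L)
  have mul: "L.mul x y = x \<otimes> y" if "x \<in> carrier B" "y \<in> carrier B" for x y
  proof -
    have "L.mul x y = add (add x y) (h (k x y))"
      using that by (simp add: L.mul_def commutator_central)
    also have "\<dots> = add x y \<otimes> h (k x y)"
      using that by (simp add: add_center commutator_central)
    also have "\<dots> = x \<otimes> y"
      using that by (simp add: add_def m_assoc commutator_central)
    finally show ?thesis .
  qed
  have "mult (E_obj (L_obj B)) x y = mult B x y" for x y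
  proof (cases "x \<in> carrier B \<and> y \<in> carrier B")
    case False
    then show ?thesis
      using assms by (auto simp: L.E_obj_eq PiE_iff extensional_def)
  qed (simp add: mul)
  then show ?thesis
    by (intro monoid.equality) (auto simp: fun_eq_iff)
qed

lemma (in class2_lie) L_E:
  assumes "ladd R \<in> lcarrier R \<rightarrow>\<^sub>E lcarrier R \<rightarrow>\<^sub>E lcarrier R"
    and "lbracket R \<in> lcarrier R \<rightarrow>\<^sub>E lcarrier R \<rightarrow>\<^sub>E lcarrier R"
  shows "L_obj (E_obj R) = R"
proof -
  interpret G: class2_group "E_obj R" by (rule class2_group_E)
  have add: "G.add x y = x \<oplus> y" if "x \<in> lcarrier R" "y \<in> lcarrier R" for x y
  proof -
    let ?a = "h (br x y)"
    have a: "?a \<in> lie_center R" "neg ?a \<in> lie_center R"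
      using that by simp_all
    \<comment> \<open>Product and sum agree on central elements, so the inverse occurring in
      \<open>G.add\<close> is the negative taken in \<open>R\<close>.\<close>
    have "mul (neg ?a) ?a = lzero R"
      using that a by (simp add: mul_center)
    then have "inv\<^bsub>E_obj R\<^esub> ?a = neg ?a"
      using a that by (intro E.inv_equality) simp_all
    then have "G.add x y = mul (mul x y) (neg ?a)"
      using that by (simp add: G.add_def commutator_E bracket_central)
    also have "\<dots> = mul x y \<oplus> neg ?a"
      using that a by (simp add: mul_center)
    also have "\<dots> = x \<oplus> y"
      using that by (simp add: mul_def m_assoc)
    finally show ?thesis .
  qed
  have "ladd (L_obj (E_obj R)) x y = ladd R x y \<and> lbracket (L_obj (E_obj R)) x y = lbracket R x y" for x y
  proof (cases "x \<in> lcarrier R \<and> y \<in> lcarrier R")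
    case False
    then show ?thesis
      using assms by (auto simp: G.L_obj_eq PiE_iff extensional_def)
  qed (simp add: add commutator_E)
  then show ?thesis
    by (intro lie.equality) (auto simp: fun_eq_iff)
qed

section \<open>Homomorphisms of one structure are homomorphisms of the other\<close>

lemma hom_L:
  assumes "class2_group B1" "class2_group B2" and f: "f \<in> hom B1 B2"
  shows "f \<in> lie_hom (L_obj B1) (L_obj B2)"
proof -
  interpret B1: class2_group B1 by fact
  interpret B2: class2_group B2 by fact
  interpret f: group_hom B1 B2 f by unfold_locales (fact f)
  have k: "f (B1.k x y) = B2.k (f x) (f y)" if "x \<in> carrier B1" "y \<in> carrier B1" for x y
    using that by (simp add: commutator_def)
  text \<open>A homomorphism need not preserve centers, but \<open>f (h [x, y])\<close> and \<open>h [f x, f y]\<close>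
    have the same square and the latter is central, so they differ by an involution.\<close>
  have h: "f (B1.h (B1.k x y)) = B2.h (B2.k (f x) (f y))" if xy: "x \<in> carrier B1" "y \<in> carrier B1" for x y
  proof -
    define u v where "u = f (B1.h (B1.k x y))" and "v = B2.h (B2.k (f x) (f y))"
    have [simp]: "u \<in> carrier B2" and v: "v \<in> center B2"
      using xy by (simp_all add: u_def v_def B1.commutator_central B2.commutator_central)
    have [simp]: "v \<in> carrier B2"
      using v by simp
    have "u \<otimes>\<^bsub>B2\<^esub> u = f (B1.k x y)"
      using xy by (simp add: u_def B1.commutator_central B1.h_double flip: f.hom_mult)
    also have "\<dots> = v \<otimes>\<^bsub>B2\<^esub> v"
      using xy by (simp add: v_def k B2.commutator_central B2.h_double)
    finally have uv: "u \<otimes>\<^bsub>B2\<^esub> u = v \<otimes>\<^bsub>B2\<^esub> v" .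
    \<comment> \<open>Centrality of \<open>v\<close> lets the first inverse of \<open>v\<close> move
      to the far right, so that \<open>u\<close> meets \<open>u\<close> and \<open>uv\<close>
      applies.\<close>
    have "(u \<otimes>\<^bsub>B2\<^esub> inv\<^bsub>B2\<^esub> v) \<otimes>\<^bsub>B2\<^esub> (u \<otimes>\<^bsub>B2\<^esub> inv\<^bsub>B2\<^esub> v) = u \<otimes>\<^bsub>B2\<^esub> (u \<otimes>\<^bsub>B2\<^esub> inv\<^bsub>B2\<^esub> v) \<otimes>\<^bsub>B2\<^esub> inv\<^bsub>B2\<^esub> v"
      using v B2.center_comm[of "inv\<^bsub>B2\<^esub> v" "u \<otimes>\<^bsub>B2\<^esub> inv\<^bsub>B2\<^esub> v"] by (simp add: B2.m_assoc)
    also have "\<dots> = u \<otimes>\<^bsub>B2\<^esub> u \<otimes>\<^bsub>B2\<^esub> inv\<^bsub>B2\<^esub> v \<otimes>\<^bsub>B2\<^esub> inv\<^bsub>B2\<^esub> v"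
      by (simp add: B2.m_assoc)
    also have "u \<otimes>\<^bsub>B2\<^esub> u \<otimes>\<^bsub>B2\<^esub> inv\<^bsub>B2\<^esub> v = v"
      by (simp add: uv B2.m_assoc)
    also have "v \<otimes>\<^bsub>B2\<^esub> inv\<^bsub>B2\<^esub> v = \<one>\<^bsub>B2\<^esub>"
      by simp
    finally have "u \<otimes>\<^bsub>B2\<^esub> inv\<^bsub>B2\<^esub> v = \<one>\<^bsub>B2\<^esub>"
      by (rule B2.involution_eq_one[rotated]) simp
    then have "u = v"
      using B2.inv_equality[of u "inv\<^bsub>B2\<^esub> v"] by simp
    then show ?thesis by (simp add: u_def v_def)
  qed
  have "f (B1.add x y) = B2.add (f x) (f y)" if "x \<in> carrier B1" "y \<in> carrier B1" for x y
    using that by (simp add: B1.add_def B2.add_def h B1.commutator_central)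
  then show ?thesis
    by (auto simp: lie_hom_def hom_def add_group_simps k)
qed

text \<open>Sums and brackets are preserved by assumption, so the point is compatibility with
  halving. The images \<open>u\<close> and \<open>v\<close> of the two halvings have the same
  double, so their difference is an involution and vanishes by
  \<open>S.involution_eq_zero\<close>.\<close>

lemma hom_E:
  assumes "class2_lie R" "class2_lie S" and f: "f \<in> lie_hom R S"
  shows "f \<in> hom (E_obj R) (E_obj S)"
proof -
  interpret R: class2_lie R by fact
  interpret S: class2_lie S by fact
  have closed [simp]: "f x \<in> lcarrier S" if "x \<in> lcarrier R" for x
    using f that by (auto simp: lie_hom_def hom_def add_group_simps)
  have add: "f (ladd R x y) = ladd S (f x) (f y)" and br: "f (R.br x y) = S.br (f x) (f y)"
    if "x \<in> lcarrier R" "y \<in> lcarrier R" for x y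
    using f that by (auto simp: lie_hom_def hom_def add_group_simps)
  have h: "f (R.h (R.br x y)) = S.h (S.br (f x) (f y))" if xy: "x \<in> lcarrier R" "y \<in> lcarrier R" for x y
  proof -
    define u v where "u = f (R.h (R.br x y))" and "v = S.h (S.br (f x) (f y))"
    have [simp]: "u \<in> lcarrier S" "v \<in> lcarrier S"
      using xy by (simp_all add: u_def v_def)
    have "ladd S u u = f (R.br x y)"
      using xy by (simp add: u_def R.bracket_central R.h_double flip: add)
    also have "\<dots> = ladd S v v"
      using xy by (simp add: v_def br S.bracket_central S.h_double)
    finally have uv: "ladd S u u = ladd S v v" .
    have "ladd S (ladd S u (S.neg v)) (ladd S u (S.neg v)) = ladd S (ladd S u u) (ladd S (S.neg v) (S.neg v))"
      by (simp add: S.m_ac)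
    also have "\<dots> = ladd S (ladd S v (S.neg v)) (ladd S v (S.neg v))"
      by (simp only: uv S.m_ac S.m_closed S.inv_closed \<open>v \<in> lcarrier S\<close>)
    also have "\<dots> = lzero S"
      by simp
    finally have "ladd S u (S.neg v) = lzero S"
      by (rule S.involution_eq_zero[rotated]) simp
    then have "u = v"
      using S.inv_equality[of u "S.neg v"] by simp
    then show ?thesis by (simp add: u_def v_def)
  qed
  have "f (R.mul x y) = S.mul (f x) (f y)" if "x \<in> lcarrier R" "y \<in> lcarrier R" for x y
    using that by (simp add: R.mul_def S.mul_def h add)
  then show ?thesis
    by (auto simp: hom_def)
qed

section \<open>The two categories and the functors between them\<close>

lemma Obj_groups_class2_iff:
  "B \<in> Obj groups_class2 \<longleftrightarrow> class2_group B \<and> mult B \<in> carrier B \<rightarrow>\<^sub>E carrier B \<rightarrow>\<^sub>E carrier B"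
  by (auto simp: groups_class2_def group_class2_def class2_group_def class2_group_axioms_def
      group.comm_quotient_center_iff)

lemma Obj_lie_rings_class2_iff:
  "R \<in> Obj lie_rings_class2 \<longleftrightarrow> class2_lie R \<and>
    ladd R \<in> lcarrier R \<rightarrow>\<^sub>E lcarrier R \<rightarrow>\<^sub>E lcarrier R \<and>
    lbracket R \<in> lcarrier R \<rightarrow>\<^sub>E lcarrier R \<rightarrow>\<^sub>E lcarrier R"
  by (auto simp: lie_rings_class2_def class2_lie_def lie_class2_iff)

lemma class2_lie_Obj: "R \<in> Obj lie_rings_class2 \<Longrightarrow> class2_lie R"
  by (simp add: Obj_lie_rings_class2_iff)

lemma class2_group_Obj: "B \<in> Obj groups_class2 \<Longrightarrow> class2_group B"
  by (simp add: Obj_groups_class2_iff)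

lemma groups_class2_simps:
  "Hom groups_class2 B1 B2 = hom B1 B2 \<inter> extensional (carrier B1)"
  "Ident groups_class2 B = (\<lambda>x\<in>carrier B. x)"
  "Comp groups_class2 B1 B2 B3 g f = compose (carrier B1) g f"
  by (simp_all add: groups_class2_def)

lemma lie_rings_class2_simps:
  "Hom lie_rings_class2 R S = lie_hom R S \<inter> extensional (lcarrier R)"
  "Ident lie_rings_class2 R = (\<lambda>x\<in>lcarrier R. x)"
  "Comp lie_rings_class2 R S T g f = compose (lcarrier R) g f"
  by (simp_all add: lie_rings_class2_def)

lemma compose_id_right:
  assumes "f \<in> extensional A"
  shows "compose A f (\<lambda>x\<in>A. x) = f"
  using assms by (intro extensionalityI[of _ A]) (auto simp: compose_def)

lemma compose_id_left:
  assumes "f \<in> extensional A" "f \<in> A \<rightarrow> B"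
  shows "compose A (\<lambda>x\<in>B. x) f = f"
  using assms by (intro extensionalityI[of _ A]) (auto simp: compose_def)

text \<open>For extensional maps between carriers \<open>U X\<close>, the unit and associativity
  laws of \<open>compose\<close> hold automatically. What is left for each category is that
  identities and composites are again homomorphisms.\<close>

lemma category_concrete:
  assumes "\<And>X Y. Hom C X Y \<subseteq> (U X \<rightarrow> U Y) \<inter> extensional (U X)"
    and "\<And>X. Ident C X = (\<lambda>x\<in>U X. x)"
    and "\<And>X Y Z g f. Comp C X Y Z g f = compose (U X) g f"
    and "\<And>X. X \<in> Obj C \<Longrightarrow> Ident C X \<in> Hom C X X"
    and "\<And>X Y Z g f. X \<in> Obj C \<Longrightarrow> f \<in> Hom C X Y \<Longrightarrow> g \<in> Hom C Y Z \<Longrightarrow> Comp C X Y Z g f \<in> Hom C X Z"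
  shows "category C"
  unfolding category_def
proof (intro conjI ballI)
  fix X Y f assume "f \<in> Hom C X Y"
  then have f: "f \<in> U X \<rightarrow> U Y" "f \<in> extensional (U X)"
    using assms(1)[THEN subsetD] by blast+
  show "Comp C X X Y f (Ident C X) = f" "Comp C X Y Y (Ident C Y) f = f"
    using f by (simp_all add: assms(2,3) compose_id_right compose_id_left)
next
  fix W X Y Z f g h assume "f \<in> Hom C W X"
  then have "f \<in> U W \<rightarrow> U X"
    using assms(1)[THEN subsetD] by blast+
  then show "Comp C W Y Z h (Comp C W X Y g f) = Comp C W X Z (Comp C X Y Z h g) f"
    by (simp add: assms(3) compose_assoc)
qed (use assms(4,5) in blast)+

lemma category_groups_class2: "category groups_class2"
proof -
  have "(\<lambda>x\<in>carrier B. x) \<in> hom B B" if "B \<in> Obj groups_class2" for B :: "'a monoid"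
  proof -
    interpret class2_group B using that by (rule class2_group_Obj)
    show ?thesis by (auto simp: hom_def)
  qed
  moreover have "compose (carrier X) g f \<in> hom X Z"
    if "f \<in> hom X Y" "g \<in> hom Y Z" "X \<in> Obj groups_class2" for X Y Z :: "'a monoid" and f g
  proof -
    interpret class2_group X using that(3) by (rule class2_group_Obj)
    \<comment> \<open>The composite is restricted to the carrier of \<open>X\<close>; closure of
      that carrier under the product is what allows evaluating it at a product.\<close>
    show ?thesis using that by (auto simp: hom_def compose_def Pi_iff)
  qed
  ultimately show ?thesis
    by (intro category_concrete[where U = carrier]) (auto simp: groups_class2_simps dest: hom_in_carrier)
qed

lemma category_lie_rings_class2: "category lie_rings_class2"
proof -
  have "(\<lambda>x\<in>lcarrier R. x) \<in> lie_hom R R" if "R \<in> Obj lie_rings_class2" for R :: "'a lie"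
  proof -
    interpret class2_lie R using that by (rule class2_lie_Obj)
    show ?thesis by (auto simp: lie_hom_def hom_def add_group_simps)
  qed
  moreover have "compose (lcarrier X) g f \<in> lie_hom X Z"
    if "f \<in> lie_hom X Y" "g \<in> lie_hom Y Z" "X \<in> Obj lie_rings_class2" for X Y Z :: "'a lie" and f g
  proof -
    interpret class2_lie X using that(3) by (rule class2_lie_Obj)
    show ?thesis using that by (auto simp: lie_hom_def hom_def compose_def Pi_iff add_group_simps)
  qed
  moreover have "f x \<in> lcarrier Y" if "f \<in> lie_hom X Y" "x \<in> lcarrier X" for X Y :: "'a lie" and f x
    using that
    by (auto simp: lie_hom_def hom_def add_group_simps)
  ultimately show ?thesis
    by (intro category_concrete[where U = lcarrier]) (auto simp: lie_rings_class2_simps)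
qed

lemma L_obj_Obj:
  assumes "B \<in> Obj groups_class2"
  shows "L_obj B \<in> Obj lie_rings_class2"
proof -
  interpret class2_group B using assms by (rule class2_group_Obj)
  show ?thesis
    by (simp add: Obj_lie_rings_class2_iff class2_lie_L) (auto simp: L_obj_eq commutator_central)
qed

lemma E_obj_Obj:
  assumes "R \<in> Obj lie_rings_class2"
  shows "E_obj R \<in> Obj groups_class2"
proof -
  interpret class2_lie R using assms by (rule class2_lie_Obj)
  show ?thesis
    by (simp add: Obj_groups_class2_iff class2_group_E) (auto simp: E_obj_eq)
qed

text \<open>Underlying sets and maps do not change, so identities and composites are literally the
  same functions. The content lies in \<open>L_obj_Obj\<close> and \<open>hom_L\<close>.\<close>

lemma functor_L: "is_functor groups_class2 lie_rings_class2 L_obj L_mor"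
  unfolding is_functor_def groups_class2_simps lie_rings_class2_simps L_mor_def
  by (auto simp: category_groups_class2 category_lie_rings_class2 L_obj_Obj
      class2_group_Obj class2_group.L_obj_simps(1) intro: hom_L)

lemma functor_E: "is_functor lie_rings_class2 groups_class2 E_obj E_mor"
  unfolding is_functor_def groups_class2_simps lie_rings_class2_simps E_mor_def
  by (auto simp: category_groups_class2 category_lie_rings_class2 E_obj_Obj
      class2_lie_Obj class2_lie.E_obj_simps(1) intro: hom_E)

theorem theorem4p2:
  shows "category_isomorphism
           (groups_class2 :: ('a monoid, 'a \<Rightarrow> 'a) cat)
           (lie_rings_class2 :: ('a lie, 'a \<Rightarrow> 'a) cat)
           L_obj L_mor E_obj E_mor"
  \<comment> \<open>Both maps on morphisms are the identity, so beyond functoriality only the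
    equalities of objects \<open>E_L\<close> and \<open>L_E\<close> remain.\<close>
  unfolding category_isomorphism_def left_inverse_functor_def
  by (auto simp: functor_L functor_E L_mor_def E_mor_def Obj_groups_class2_iff
      Obj_lie_rings_class2_iff class2_group.E_L class2_lie.L_E)

end
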